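(* Let $1<M<2$ and suppose that $c<\mathrm{rad}(abc)^M$ for all coprime positive integers $a,b,c$ with $a+b=c$. Then for each real $\eta>1-\frac{2-M}{4M}$ the following holds: for all but finitely many triples of coprime positive integers $(a,b,c)$ satisfying $a+b=c$ and not of the form $(1,N,q)$ with $q$ prime (up to order), there is $\psi\in\mathscr{T}(a,b)$ such that $a,b$ are $\psi$-independent and $\|\psi\|<c^{\eta}$.
   Context: For a prime $p$, $v_p$ is the $p$-adic valuation. For a non-zero integer $n$, $\mathrm{supp}(n)$ is the set of primes dividing $n$; for a positive integer $n$, $\mathrm{rad}(n)$ is the product of the distinct primes dividing $n$. Let $\Omega$ be the free $\mathbb{Z}$-module on symbols $\xi_p$, one for each prime $p$. Define $\mathrm{d}:\mathbb{Z}\to\Omega$ by $\mathrm{d}0=0$ and $\mathrm{d}n=\sum_{p\mid n}\frac{n\,v_p(n)}{p}\,\xi_p$ for $n\ne 0$ (the coefficients are integers). For a $\mathbb{Z}$-linear map $\psi:\Omega\to\mathbb{Z}$ put $\|\psi\|=\sup_p|\psi(\xi_p)|$. Let $\mathscr{T}$ be the $\mathbb{Z}$-module of all $\mathbb{Z}$-linear $\psi:\Omega\to\mathbb{Z}$ with $\|\psi\|<\infty$. For $\psi\in\mathscr{T}$ let $\mathrm{d}^\psi=\psi\circ\mathrm{d}:\mathbb{Z}\to\mathbb{Z}$ and $\mathrm{supp}(\psi)=\{p:\psi(\xi_p)\neq0\}$. For positive integers $a,b$, $$\mathscr{T}(a,b)=\{\psi\in\mathscr{T}:\ \mathrm{supp}(\psi)\subseteq\mathrm{supp}(ab(a+b))\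 \text{and}\ \mathrm{d}^\psi(a+b)=\mathrm{d}^\psi a+\mathrm{d}^\psi b\}.$$ Integers $a,b$ are $\psi$-independent if $W^\psi(a,b):=a\,\mathrm{d}^\psi b-b\,\mathrm{d}^\psi a\neq 0$. A triple is "of the form $(1,N,q)$ up to order" if some permutation of it equals $(1,N,q)$ with $N$ a positive integer and $q$ prime. *)

theory Defs
  imports
    "HOL-Analysis.Analysis"
    "HOL-Library.Poly_Mapping"
    "HOL-Library.Multiset"
    "HOL-Computational_Algebra.Computational_Algebra"
begin

typedef prime_number = "{p::nat. prime p}"
  morphisms nat_of_prime prime_of_nat
  using two_is_prime_nat by blast

definition int_of_prime :: "prime_number \<Rightarrow> int" where
  "int_of_prime p = int (nat_of_prime p)"

definition supp :: "int \<Rightarrow> prime_number set" where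
  "supp n = {p. int_of_prime p dvd n}"

definition rad :: "int \<Rightarrow> int" where
  "rad n = (\<Prod>p\<in>prime_factors n. p)"

text \<open>The free abelian group on the primes, with integer scalar multiplication
  \<^const>\<open>frag_cmul\<close>.\<close>

type_synonym Omega = "prime_number \<Rightarrow>\<^sub>0 int"

definition xi :: "prime_number \<Rightarrow> Omega" where
  "xi p = frag_of p"

text \<open>The sum ranges over a finite set whenever \<open>n \<noteq> 0\<close> (lemma \<open>finite_supp\<close>),
  and the integer division is exact, since \<open>p\<close> divides \<open>n\<close>.\<close>

definition d_Omega :: "int \<Rightarrow> Omega" where
  "d_Omega n = (if n = 0 then 0
          else \<Sum>p\<in>supp n.
            frag_cmul ((n * int (multiplicity (int_of_prime p) n)) div int_of_prime p) (xi p))"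

definition psi_norm :: "(Omega \<Rightarrow> int) \<Rightarrow> ereal" where
  "psi_norm \<psi> = (SUP p. ereal (real_of_int \<bar>\<psi> (xi p)\<bar>))"

definition T_module :: "(Omega \<Rightarrow> int) set" where
  "T_module = {\<psi>. module_hom frag_cmul times \<psi> \<and> psi_norm \<psi> < \<infinity>}"

definition d_psi :: "(Omega \<Rightarrow> int) \<Rightarrow> int \<Rightarrow> int" where
  "d_psi \<psi> = \<psi> \<circ> d_Omega"

definition supp_psi :: "(Omega \<Rightarrow> int) \<Rightarrow> prime_number set" where
  "supp_psi \<psi> = {p. \<psi> (xi p) \<noteq> 0}"

definition T_pair :: "int \<Rightarrow> int \<Rightarrow> (Omega \<Rightarrow> int) set" where
  "T_pair a b = {\<psi> \<in> T_module. supp_psi \<psi> \<subseteq> supp (a * b * (a + b)) \<and>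
     d_psi \<psi> (a + b) = d_psi \<psi> a + d_psi \<psi> b}"

definition W_psi :: "(Omega \<Rightarrow> int) \<Rightarrow> int \<Rightarrow> int \<Rightarrow> int" where
  "W_psi \<psi> a b = a * d_psi \<psi> b - b * d_psi \<psi> a"

definition psi_independent :: "(Omega \<Rightarrow> int) \<Rightarrow> int \<Rightarrow> int \<Rightarrow> bool" where
  "psi_independent \<psi> a b \<longleftrightarrow> W_psi \<psi> a b \<noteq> 0"

text \<open>Because \<open>a + b = c\<close>, a common divisor of any two of \<open>a, b, c\<close> divides the third,
  so joint and pairwise coprimality agree here (lemma \<open>abc_triple_pairwise\<close>).\<close>

definition abc_triple :: "int \<Rightarrow> int \<Rightarrow> int \<Rightarrow> bool" where
  "abc_triple a b c \<longleftrightarrow> a > 0 \<and> b > 0 \<and> c > 0 \<and> gcd a (gcd b c) = 1 \<and> a + b = c"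

definition one_N_prime_form :: "int \<Rightarrow> int \<Rightarrow> int \<Rightarrow> bool" where
  "one_N_prime_form a b c \<longleftrightarrow> (\<exists>N q. N > 0 \<and> prime q \<and> {#a, b, c#} = {#1, N, q#})"

lemma prime_int_of_prime: "prime (int_of_prime p)"
  using nat_of_prime[of p] by (simp add: int_of_prime_def)

lemma finite_supp:
  assumes "n \<noteq> 0"
  shows "finite (supp n)"
proof -
  have "int_of_prime ` supp n \<subseteq> prime_factors n"
    using assms prime_int_of_prime by (auto simp: supp_def prime_factors_dvd)
  hence "finite (int_of_prime ` supp n)"
    by (rule finite_subset) simp
  moreover have "inj_on int_of_prime (supp n)"
    by (auto simp: inj_on_def int_of_prime_def nat_of_prime_inject)
  ultimately show ?thesis
    by (rule finite_imageD)
qed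

lemma module_frag_cmul: "module (frag_cmul :: int \<Rightarrow> Omega \<Rightarrow> Omega)"
  by unfold_locales (simp_all add: frag_cmul_distrib frag_cmul_distrib2)

lemma abc_triple_pairwise:
  assumes "abc_triple a b c"
  shows "coprime a b" "coprime a c" "coprime b c"
proof -
  have c: "c = a + b" and g: "gcd a (gcd b c) = 1"
    using assms by (auto simp: abc_triple_def)
  have "gcd a b dvd gcd a (gcd b c)"
    by (simp add: c)
  thus ab: "coprime a b"
    using g by (simp add: coprime_iff_gcd_eq_1)
  show "coprime a c"
    using ab by (simp add: c coprime_iff_gcd_eq_1)
  show "coprime b c"
    using ab by (simp add: c coprime_iff_gcd_eq_1 gcd.commute add.commute[of a b])
qed

end

theory Submission
  imports Defs
begin

text \<open>
  A map \<open>\<psi>\<close> in \<open>T_pair a b\<close> is an integer vector \<open>x\<close> indexed by the primes dividing \<open>abc\<close> that solves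
  one linear equation. If \<open>W\<close> vanishes on it, then \<open>a\<close>, \<open>b\<close>, \<open>c\<close> have the same logarithmic derivative
  \<open>t\<close>, an integer, and looking at each prime \<open>r\<close> gives \<open>r dvd v x\<^sub>r\<close> with \<open>v\<close> the multiplicity of
  \<open>r\<close> in \<open>abc\<close>: dependent solutions are sparse. Put \<open>Y = c powr (1 / (2 M) - 1 / 4)\<close>.

  If primes \<open>p, q > Y\<close> divide different members of the triple, there is an independent solution
  supported on \<open>{p, q}\<close> with entries at most about \<open>c / Y\<close>. Otherwise there are \<open>p, q\<close> dividing
  different members with \<open>pq \<le> Y \<surd>c\<close>; this is where the triples \<open>(1, N, q)\<close> have to be excluded: in a
  triple containing \<open>1\<close> one of the two primes is the least prime factor of a composite member.
  A dependent solution is determined by its coordinates off \<open>{p, q}\<close>, so counting points of a box \<open>[0, H)\<close> in a fibre of the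
  linear form produces an independent solution as soon as \<open>H\<^sup>2\<close> and \<open>H rad(abc) / (pq)\<close> both exceed
  \<open>c\<close> times a power of the number of divisors of \<open>abc\<close>. Since \<open>rad(abc) > c powr (1 / M)\<close>, both cases
  lead to the exponent \<open>5 / 4 - 1 / (2 M) = 1 - (2 - M) / (4 M)\<close>.
\<close>

section \<open>A pigeonhole principle for linear forms\<close>

text \<open>Members of one residue class modulo \<open>m\<close> have distinct quotients by
  \<open>m\<close>, and these quotients lie between 0 and \<open>(H - 1) div m\<close>.\<close>

lemma card_residue_class_le:
  fixes m H :: nat and t0 :: int
  assumes "m \<ge> 1" "H \<ge> 1"
  shows "card {t \<in> {0..<int H}. int m dvd t - t0} \<le> (H - 1) div m + 1"
proof -
  have "inj_on (\<lambda>t. t div int m) {t \<in> {0..<int H}. int m dvd t - t0}"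
  proof (rule inj_onI)
    fix s t assume s: "s \<in> {t \<in> {0..<int H}. int m dvd t - t0}"
      and t: "t \<in> {t \<in> {0..<int H}. int m dvd t - t0}" and eq: "s div int m = t div int m"
    have "int m dvd s - t" using dvd_diff[of "int m" "s - t0" "t - t0"] s t by simp
    hence "s mod int m = t mod int m" by (simp add: mod_eq_dvd_iff)
    thus "s = t" using eq by (metis div_mult_mod_eq)
  qed
  moreover have "(\<lambda>t. t div int m) ` {t \<in> {0..<int H}. int m dvd t - t0} \<subseteq> {0..int ((H - 1) div m)}"
  proof safe
    fix t assume t: "t \<in> {0..<int H}"
    have "t div int m \<le> int (H - 1) div int m"
      using t assms by (intro zdiv_mono1) auto
    thus "t div int m \<in> {0..int ((H - 1) div m)}"
      using t assms by (simp add: zdiv_int pos_imp_zdiv_nonneg_iff)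
  qed
  ultimately have "card {t \<in> {0..<int H}. int m dvd t - t0} \<le> card {0..int ((H - 1) div m)}"
    by (intro card_inj_on_le) auto
  thus ?thesis by simp
qed

text \<open>If all small zeros of the form \<open>e\<close> satisfied \<open>Bad\<close>, each fibre over the box \<open>{0..<H}\<close>
  would be confined to one residue class in every coordinate of \<open>T\<close>, and determined by them.\<close>

lemma pigeonhole_linear_form:
  fixes e :: "'a \<Rightarrow> int" and m :: "'a \<Rightarrow> nat" and H N :: nat
  assumes S: "finite S" "T \<subseteq> S" and m: "\<And>r. r \<in> T \<Longrightarrow> m r \<ge> 1" and H: "H \<ge> 1"
    and E: "N \<ge> 1" "(\<Sum>r\<in>S. \<bar>e r\<bar>) \<le> int N"
    and congruent: "\<And>z r. Bad z \<Longrightarrow> r \<in> T \<Longrightarrow> int (m r) dvd z r"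
    and determined: "\<And>z r. Bad z \<Longrightarrow> \<forall>r\<in>T. z r = 0 \<Longrightarrow> r \<in> S \<Longrightarrow> z r = 0"
    and large: "H ^ card S > 2 * H * N * (\<Prod>r\<in>T. (H - 1) div m r + 1)"
  shows "\<exists>z. (\<forall>r. r \<notin> S \<longrightarrow> z r = 0) \<and> (\<forall>r. \<bar>z r\<bar> < int H) \<and> (\<Sum>r\<in>S. e r * z r) = 0 \<and> \<not> Bad z"
proof (rule ccontr)
  assume contr: "\<not> ?thesis"
  define B where "B = PiE S (\<lambda>_. {0..<int H})"
  define f where "f x = (\<Sum>r\<in>S. e r * x r)" for x
  define I where "I = {- (int (H - 1) * int N)..int (H - 1) * int N}"
  have cardB: "card B = H ^ card S" unfolding B_def using S by (simp add: card_PiE)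
  have finB: "finite B" unfolding B_def using S by (intro finite_PiE) auto
  have fB: "f \<in> B \<rightarrow> I"
  proof
    fix x assume x: "x \<in> B"
    have "\<bar>f x\<bar> \<le> (\<Sum>r\<in>S. \<bar>e r * x r\<bar>)" unfolding f_def by (rule sum_abs)
    also have "\<dots> \<le> (\<Sum>r\<in>S. \<bar>e r\<bar> * int (H - 1))"
    proof (rule sum_mono)
      fix r assume "r \<in> S"
      hence "x r \<in> {0..<int H}" using x by (auto simp: B_def)
      thus "\<bar>e r * x r\<bar> \<le> \<bar>e r\<bar> * int (H - 1)"
        unfolding abs_mult using H by (intro mult_left_mono) auto
    qed
    also have "\<dots> = int (H - 1) * (\<Sum>r\<in>S. \<bar>e r\<bar>)"
      by (metis sum_distrib_right mult.commute)
    also have "\<dots> \<le> int (H - 1) * int N" using E by (intro mult_left_mono) auto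
    finally show "f x \<in> I" unfolding I_def by auto
  qed
  \<comment> \<open>The value 0 accounts for the final 1, which \<open>N \<ge> 1\<close> absorbs in
    the next line.\<close>
  have "card I = 2 * (H - 1) * N + 1" unfolding I_def by (simp add: nat_eq_iff)
  also have "\<dots> \<le> 2 * H * N"
  proof -
    obtain h where "H = Suc h" using H by (cases H) auto
    thus ?thesis using E by simp
  qed
  finally have cardI: "card I \<le> 2 * H * N" .
  have "finite I" "I \<noteq> {}" unfolding I_def by auto
  from pigeonhole_card[OF fB finB this] obtain y
    where y: "card (f -` {y} \<inter> B) * card I \<ge> card B" by blast
  define F where "F = f -` {y} \<inter> B"
  have "card F \<le> (\<Prod>r\<in>T. (H - 1) div m r + 1)"
  proof (cases "F = {}")
    case False
    then obtain x0 where x0: "x0 \<in> F" by auto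
    \<comment> \<open>The difference of two points of a fibre is a zero of the form with entries
      below \<open>H\<close> in absolute value, so \<open>contr\<close> makes it
      \<open>Bad\<close>.\<close>
    have bad: "Bad (\<lambda>r. if r \<in> S then x r - x' r else 0)" (is "Bad ?z") if x: "x \<in> F" "x' \<in> F" for x x'
    proof -
      have "\<bar>?z r\<bar> < int H" for r
      proof (cases "r \<in> S")
        case True
        hence "x r \<in> {0..<int H}" "x' r \<in> {0..<int H}" using x by (auto simp: F_def B_def)
        thus ?thesis by auto
      qed (use H in auto)
      moreover have "(\<Sum>r\<in>S. e r * ?z r) = f x - f x'"
        unfolding f_def by (simp add: right_diff_distrib sum_subtractf)
      hence "(\<Sum>r\<in>S. e r * ?z r) = 0" using x by (simp add: F_def)
      ultimately show ?thesis using contr[unfolded not_ex, THEN spec[of _ ?z]] by auto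
    qed
    have "inj_on (\<lambda>x. restrict x T) F"
    proof (rule inj_onI)
      fix x x' assume x: "x \<in> F" "x' \<in> F" and eq: "restrict x T = restrict x' T"
      have "x r = x' r" if "r \<in> T" for r
        using fun_cong[OF eq, of r] that by simp
      hence "\<forall>r\<in>T. (if r \<in> S then x r - x' r else 0) = 0" by simp
      hence "x r = x' r" if "r \<in> S" for r
        using determined[OF bad[OF x]] that by fastforce
      thus "x = x'" using x PiE_ext[of x S "\<lambda>_. {0..<int H}" x'] by (simp add: F_def B_def)
    qed
    moreover have "(\<lambda>x. restrict x T) ` F \<subseteq> PiE T (\<lambda>r. {t \<in> {0..<int H}. int (m r) dvd t - x0 r})"
    proof (rule image_subsetI, rule restrict_PiE_iff[THEN iffD2], rule ballI)
      fix x r assume x: "x \<in> F" and r: "r \<in> T"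
      have rS: "r \<in> S" using r S by auto
      have "x r \<in> {0..<int H}" using x rS by (auto simp: F_def B_def)
      moreover have "int (m r) dvd x r - x0 r"
        using congruent[OF bad[OF x x0] r] rS by simp
      ultimately show "x r \<in> {t \<in> {0..<int H}. int (m r) dvd t - x0 r}" by simp
    qed
    moreover have "finite (PiE T (\<lambda>r. {t \<in> {0..<int H}. int (m r) dvd t - x0 r}))"
    proof (rule finite_PiE)
      show "finite T" using S finite_subset by blast
      show "finite {t \<in> {0..<int H}. int (m r) dvd t - x0 r}" for r
        by (rule finite_subset[of _ "{0..<int H}"]) auto
    qed
    ultimately have "card F \<le> card (PiE T (\<lambda>r. {t \<in> {0..<int H}. int (m r) dvd t - x0 r}))"
      by (intro card_inj_on_le) auto
    also have "\<dots> = (\<Prod>r\<in>T. card {t \<in> {0..<int H}. int (m r) dvd t - x0 r})"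
      using S finite_subset by (intro card_PiE) blast
    also have "\<dots> \<le> (\<Prod>r\<in>T. (H - 1) div m r + 1)"
      by (intro prod_mono conjI card_residue_class_le m H) simp_all
    finally show ?thesis .
  qed auto
  hence "card F * card I \<le> (\<Prod>r\<in>T. (H - 1) div m r + 1) * (2 * H * N)"
    using cardI by (rule mult_le_mono)
  thus False using y large cardB unfolding F_def by (simp add: mult.commute)
qed

section \<open>The counting condition as an inequality between real numbers\<close>

lemma min_prod_le:
  fixes m :: "'a \<Rightarrow> real"
  assumes "finite T" "h \<ge> 1" "\<And>r. r \<in> T \<Longrightarrow> m r \<ge> 1"
  shows "min h (\<Prod>r\<in>T. m r) \<le> (\<Prod>r\<in>T. min h (m r))"
  using assms
proof (induction T)
  case (insert r T)
  have ge: "(\<Prod>r\<in>T. m r) \<ge> 1" "(\<Prod>r\<in>T. min h (m r)) \<ge> 1" using insert by (auto intro!: prod_ge_1)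
  have IH: "min h (\<Prod>r\<in>T. m r) \<le> (\<Prod>r\<in>T. min h (m r))" using insert by auto
  have m: "m r \<ge> 1" using insert by auto
  have "min h (m r * prod m T) \<le> min h (m r) * min h (prod m T)"
  \<comment> \<open>If one factor reaches \<open>h\<close>, its capped value is \<open>h\<close> and
    the other capped factor is at least 1. Otherwise the caps on the right are inactive.\<close>
  proof (cases "m r \<ge> h \<or> prod m T \<ge> h")
    case True
    have "h \<le> min h (m r) * min h (prod m T)"
      using True mult_mono[of h "min h (m r)" 1 "min h (prod m T)"] mult_mono[of 1 "min h (m r)" h "min h (prod m T)"]
        m ge insert.prems(1) by auto
    thus ?thesis by auto
  qed auto
  also have "\<dots> \<le> min h (m r) * (\<Prod>r\<in>T. min h (m r))"
    using IH m insert.prems(1) by (intro mult_left_mono) auto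
  finally show ?case using insert by simp
qed auto

text \<open>Each factor is at most \<open>2 * H / min H (m r)\<close>; the cap is needed because the
  factor stays 1 when \<open>m r > H\<close>. The \<open>card T\<close> twos and the leading 2 make
  up \<open>2 ^ (n - 1)\<close>. After cancelling \<open>H ^ (n - 1)\<close>, the claim is
  \<open>large\<close> with every factor capped, and \<open>min_prod_le\<close> supplies
  that.\<close>

lemma pigeonhole_condition:
  fixes m :: "'a \<Rightarrow> nat" and H N n :: nat
  assumes T: "finite T" "n = card T + 2" and m: "\<And>r. r \<in> T \<Longrightarrow> m r \<ge> 1" and H: "H \<ge> 1"
    and large: "real H * min (real H) (\<Prod>r\<in>T. real (m r)) > real N * 2 ^ (n - 1)"
  shows "H ^ n > 2 * H * N * (\<Prod>r\<in>T. (H - 1) div m r + 1)"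
proof -
  let ?h = "real H" and ?P = "\<Prod>r\<in>T. min (real H) (real (m r))"
  have P: "?P > 0" using m H by (intro prod_pos) (auto simp: Suc_le_eq)
  have "real (\<Prod>r\<in>T. (H - 1) div m r + 1) = (\<Prod>r\<in>T. real ((H - 1) div m r + 1))" by simp
  also have "\<dots> \<le> (\<Prod>r\<in>T. 2 * ?h / min ?h (m r))"
  proof (rule prod_mono, safe)
    fix r assume "r \<in> T"
    hence mr: "m r \<ge> 1" using m by auto
    show "real ((H - 1) div m r + 1) \<le> 2 * ?h / min ?h (m r)"
    proof (cases "m r \<le> H")
      case True
      have "real ((H - 1) div m r) \<le> real (H - 1) / real (m r)" by (rule of_nat_div_le_of_nat)
      also have "\<dots> \<le> ?h / m r" using mr by (intro divide_right_mono) auto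
      finally have "real ((H - 1) div m r + 1) \<le> ?h / m r + 1" by simp
      also have "\<dots> \<le> 2 * ?h / m r" using True mr by (simp add: field_simps)
      finally show ?thesis using True by simp
    qed (use H in auto)
  qed simp
  also have "\<dots> = (2 * ?h) ^ card T / ?P" by (simp add: prod_dividef)
  finally have "real (\<Prod>r\<in>T. (H - 1) div m r + 1) \<le> (2 * ?h) ^ card T / ?P" .
  hence "real (2 * H * N * (\<Prod>r\<in>T. (H - 1) div m r + 1)) \<le> 2 * ?h * N * ((2 * ?h) ^ card T / ?P)"
    unfolding of_nat_mult of_nat_numeral by (intro mult_left_mono) auto
  also have "\<dots> = (?h * ?h ^ card T) * (real N * 2 ^ (n - 1)) / ?P"
    using T by (simp add: power_mult_distrib)
  also have "\<dots> < (?h * ?h ^ card T) * (?h * ?P) / ?P"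
  proof -
    have "real N * 2 ^ (n - 1) < ?h * ?P"
      by (rule less_le_trans[OF large], rule mult_left_mono, rule min_prod_le) (use T m H in \<open>simp_all\<close>)
    thus ?thesis using P H by (intro divide_strict_right_mono mult_strict_left_mono) auto
  qed
  also have "\<dots> = ?h * ?h ^ card T * ?h"
    using nonzero_mult_div_cancel_right[of ?P "?h * ?h ^ card T * ?h"] P by (metis mult.assoc less_irrefl)
  also have "\<dots> = real (H ^ n)" using T by simp
  finally show ?thesis by (simp only: of_nat_less_iff)
qed

section \<open>Arithmetic derivatives and the divisor bound\<close>

abbreviation val :: "prime_number \<Rightarrow> int \<Rightarrow> nat" where
  "val r n \<equiv> multiplicity (int_of_prime r) n"

text \<open>The coefficient of \<open>xi r\<close> in \<open>d_Omega n\<close>. It is 0 at primes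
  not dividing \<open>n\<close>, so sums over \<open>supp n\<close> extend to any larger finite
  set.\<close>

definition coef :: "int \<Rightarrow> prime_number \<Rightarrow> int" where
  "coef n r = (n * int (val r n)) div int_of_prime r"

lemma prime_elem_int_of_prime: "prime_elem (int_of_prime r)"
  using prime_int_of_prime by (rule prime_imp_prime_elem)

lemma int_of_prime_ge_2: "int_of_prime r \<ge> 2"
  using prime_int_of_prime by (rule prime_ge_2_int)

lemma int_of_prime_pos: "int_of_prime r > 0"
  using int_of_prime_ge_2[of r] by simp

lemma inj_int_of_prime: "inj int_of_prime"
  by (auto simp: inj_def int_of_prime_def nat_of_prime_inject)

lemma int_of_prime_dvd_iff: "int_of_prime r dvd int_of_prime s \<longleftrightarrow> r = s"
  by (metis int_of_prime_def nat_of_prime_inject of_nat_eq_iff prime_int_of_prime primes_dvd_imp_eq dvd_refl)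

lemma val_eq_0: "\<not> int_of_prime r dvd n \<Longrightarrow> val r n = 0"
  by (rule not_dvd_imp_multiplicity_0)

lemma val_pos: "n \<noteq> 0 \<Longrightarrow> int_of_prime r dvd n \<Longrightarrow> val r n > 0"
  by (rule prime_multiplicity_gt_zero_iff[THEN iffD2, OF prime_elem_int_of_prime])

lemma coef_eq_0: "\<not> int_of_prime r dvd n \<Longrightarrow> coef n r = 0"
  by (simp add: coef_def val_eq_0)

text \<open>The division in \<open>coef\<close> is exact: either \<open>r\<close> divides
  \<open>n\<close>, or the multiplicity is 0.\<close>

lemma int_of_prime_times_coef: "int_of_prime r * coef n r = n * int (val r n)"
proof (cases "int_of_prime r dvd n")
  case True
  thus ?thesis unfolding coef_def by (intro dvd_mult_div_cancel) simp
qed (simp add: coef_eq_0 val_eq_0)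

lemma coef_nonneg: "n \<ge> 0 \<Longrightarrow> coef n r \<ge> 0"
  using int_of_prime_ge_2[of r] unfolding coef_def by (intro pos_imp_zdiv_nonneg_iff[THEN iffD2]) auto

lemma coef_pos: "n > 0 \<Longrightarrow> int_of_prime r dvd n \<Longrightarrow> coef n r > 0"
  using int_of_prime_times_coef[of r n] val_pos[of n r] coef_nonneg[of n r]
  by (cases "coef n r = 0") auto

lemma bij_betw_supp_prime_factors:
  assumes "n \<noteq> 0"
  shows "bij_betw int_of_prime (supp n) (prime_factors n)"
proof (rule bij_betwI')
  fix p assume "p \<in> prime_factors n"
  hence p: "prime p" "p dvd n" by auto
  hence "int_of_prime (prime_of_nat (nat p)) = p"
    using prime_ge_2_int[of p] by (simp add: int_of_prime_def prime_of_nat_inverse prime_nat_iff_prime)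
  thus "\<exists>r\<in>supp n. p = int_of_prime r" using p by (metis (mono_tags) mem_Collect_eq supp_def)
next
  fix r assume "r \<in> supp n"
  thus "int_of_prime r \<in> prime_factors n"
    using assms prime_int_of_prime by (auto simp: supp_def prime_factors_dvd)
qed (metis int_of_prime_dvd_iff dvd_refl)

lemma prod_supp_power_val:
  assumes "n > 0"
  shows "(\<Prod>r\<in>supp n. int_of_prime r ^ val r n) = n"
  using prod.reindex_bij_betw[OF bij_betw_supp_prime_factors, of n "\<lambda>p. p ^ multiplicity p n"]
    prod_prime_factors[of n] assms by simp

lemma rad_eq_prod_supp: "n \<noteq> 0 \<Longrightarrow> rad n = (\<Prod>r\<in>supp n. int_of_prime r)"
  unfolding rad_def using prod.reindex_bij_betw[OF bij_betw_supp_prime_factors, of n "\<lambda>p. p"] by simp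

lemma supp_nonempty:
  assumes "n > 1"
  shows "\<exists>r. int_of_prime r dvd n"
proof (rule ccontr)
  assume "\<not> ?thesis"
  hence "supp n = {}" by (auto simp: supp_def)
  thus False using prod_supp_power_val[of n] assms by simp
qed

lemma supp_mult: "supp (m * n) = supp m \<union> supp n"
  using prime_int_of_prime by (auto simp: supp_def prime_dvd_mult_iff)

text \<open>Modulo \<open>r ^ val r n\<close> only the \<open>r\<close>-th term survives, and it carries one factor \<open>r\<close> too few.\<close>

lemma dvd_val_times_of_dvd_derivative:
  assumes n: "n > 0" and S: "finite S" "r \<in> S" and r: "int_of_prime r dvd n"
    and dvd: "n dvd (\<Sum>s\<in>S. coef n s * z s)"
  shows "int_of_prime r dvd int (val r n) * z r"
proof -
  let ?q = "int_of_prime r ^ val r n"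
  have "?q dvd coef n s" if "s \<noteq> r" for s
  proof -
    have "?q dvd int_of_prime s * coef n s"
      unfolding int_of_prime_times_coef by (simp add: multiplicity_dvd)
    moreover have "coprime ?q (int_of_prime s)"
      using that int_of_prime_dvd_iff[of r s] prime_imp_coprime[OF prime_int_of_prime]
      by (auto intro: coprime_power_left_iff[THEN iffD2])
    ultimately show ?thesis by (simp add: coprime_dvd_mult_right_iff)
  qed
  hence "?q dvd (\<Sum>s\<in>S - {r}. coef n s * z s)" by (intro dvd_sum) auto
  moreover have "?q dvd (\<Sum>s\<in>S. coef n s * z s)"
    using dvd multiplicity_dvd dvd_trans by blast
  ultimately have "?q dvd coef n r * z r"
    using S by (simp add: sum.remove dvd_add_left_iff)
  \<comment> \<open>Multiplying by \<open>r\<close> trades \<open>coef n r\<close> for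
    \<open>n * val r n\<close>. Once the exact power \<open>?q\<close> is cancelled from
    \<open>n\<close>, one factor \<open>r\<close> is left over.\<close>
  hence "int_of_prime r * ?q dvd int_of_prime r * (coef n r * z r)" by (rule mult_dvd_mono[OF dvd_refl])
  also have "int_of_prime r * (coef n r * z r) = n * (int (val r n) * z r)"
    using int_of_prime_times_coef[of r n] by (simp add: algebra_simps)
  finally have *: "int_of_prime r * ?q dvd n * (int (val r n) * z r)" .
  obtain k where k: "n = ?q * k" "\<not> int_of_prime r dvd k"
    using multiplicity_decompose'[of n "int_of_prime r"] n int_of_prime_ge_2[of r] by (auto simp: zdvd1_eq)
  have "?q * int_of_prime r dvd ?q * (k * (int (val r n) * z r))"
    using * k(1) by (metis mult.assoc mult.commute)
  hence "int_of_prime r dvd k * (int (val r n) * z r)"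
    using int_of_prime_ge_2[of r] by simp
  thus ?thesis using k(2) prime_int_of_prime prime_dvd_mult_iff by blast
qed

section \<open>The divisor bound\<close>

lemma Suc_le_powr:
  assumes "\<delta> > 0"
  shows "real (v + 1) \<le> (1 + 1 / (\<delta> * ln 2)) * 2 powr (\<delta> * real v)"
proof -
  have "1 + \<delta> * real v * ln 2 \<le> 2 powr (\<delta> * real v)"
    using exp_ge_add_one_self[of "\<delta> * real v * ln 2"] by (simp add: powr_def)
  \<comment> \<open>The constant is chosen so that the left side expands to \<open>1 + v\<close>
    plus non-negative terms.\<close>
  hence "(1 + 1 / (\<delta> * ln 2)) * (1 + \<delta> * real v * ln 2) \<le> (1 + 1 / (\<delta> * ln 2)) * 2 powr (\<delta> * real v)"
    using assms by (intro mult_left_mono) auto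
  moreover have "(1 + 1 / (\<delta> * ln 2)) * (1 + \<delta> * real v * ln 2) =
      1 + real v + (\<delta> * real v * ln 2 + 1 / (\<delta> * ln 2))"
    using assms by (simp add: field_simps)
  moreover have "\<delta> * real v * ln 2 + 1 / (\<delta> * ln 2) \<ge> 0" using assms by simp
  ultimately show ?thesis by simp
qed

text \<open>The product is the number of divisors of \<open>n\<close>. A prime \<open>p\<close> with
  \<open>p \<ge> 2 powr (1 / \<delta>)\<close> satisfies
  \<open>p powr (\<delta> * v) \<ge> 2 ^ v \<ge> v + 1\<close> and costs nothing; each of the
  finitely many smaller primes costs a factor \<open>K\<close>.\<close>

lemma divisor_bound:
  assumes \<delta>: "\<delta> > 0"
  shows "\<exists>C\<ge>1. \<forall>n>0. real (\<Prod>r\<in>supp n. val r n + 1) \<le> C * real_of_int n powr \<delta>"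
proof -
  define K where "K = 1 + 1 / (\<delta> * ln 2)"
  have K: "K \<ge> 1" using \<delta> by (simp add: K_def)
  define B where "B = {r. real_of_int (int_of_prime r) < 2 powr (1 / \<delta>)}"
  have "B \<subseteq> int_of_prime -` {0..\<lfloor>2 powr (1 / \<delta>)\<rfloor>}"
    by (auto simp: B_def le_floor_iff less_imp_le[OF int_of_prime_pos])
  hence finB: "finite B" by (rule finite_subset) (intro finite_vimageI inj_int_of_prime finite_atLeastAtMost_int)
  have local_bound: "real (val r n + 1) \<le> (if r \<in> B then K else 1) * real_of_int (int_of_prime r ^ val r n) powr \<delta>"
    for r n
  proof -
    define p v where "p = real_of_int (int_of_prime r)" and "v = val r n"
    have p: "p \<ge> 2" using int_of_prime_ge_2[of r] by (simp add: p_def)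
    have eq: "real_of_int (int_of_prime r ^ v) powr \<delta> = p powr (\<delta> * real v)"
      using p by (simp add: p_def powr_powr powr_realpow[symmetric] mult.commute)
    show ?thesis
    proof (cases "r \<in> B")
      case True
      have "2 powr (\<delta> * real v) \<le> p powr (\<delta> * real v)" using p \<delta> by (intro powr_mono2) auto
      hence "K * 2 powr (\<delta> * real v) \<le> K * p powr (\<delta> * real v)" using K by (intro mult_left_mono) auto
      thus ?thesis using Suc_le_powr[OF \<delta>, of v] True eq by (simp add: K_def v_def)
    next
      case False
      hence "2 powr (1 / \<delta>) \<le> p" by (simp add: B_def p_def)
      hence "(2 powr (1 / \<delta>)) powr (\<delta> * real v) \<le> p powr (\<delta> * real v)" using \<delta> by (intro powr_mono2) auto
      also have "(2 powr (1 / \<delta>)) powr (\<delta> * real v) = 2 ^ v"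
        using \<delta> by (simp add: powr_powr powr_realpow)
      finally have "2 ^ v \<le> p powr (\<delta> * real v)" .
      moreover have "real (v + 1) \<le> 2 ^ v"
        using less_exp[of v] by (metis Suc_eq_plus1 Suc_leI of_nat_le_iff of_nat_numeral of_nat_power)
      ultimately show ?thesis using False eq by (simp add: v_def)
    qed
  qed
  have "real (\<Prod>r\<in>supp n. val r n + 1) \<le> K ^ card B * real_of_int n powr \<delta>" if n: "n > 0" for n
  proof -
    have fin: "finite (supp n)" using n by (intro finite_supp) auto
    have "real (\<Prod>r\<in>supp n. val r n + 1) = (\<Prod>r\<in>supp n. real (val r n + 1))" by simp
    also have "\<dots> \<le> (\<Prod>r\<in>supp n. (if r \<in> B then K else 1) * real_of_int (int_of_prime r ^ val r n) powr \<delta>)"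
      using local_bound by (intro prod_mono) auto
    also have "\<dots> = (\<Prod>r\<in>supp n. if r \<in> B then K else 1) * (\<Prod>r\<in>supp n. real_of_int (int_of_prime r ^ val r n)) powr \<delta>"
      by (simp only: prod.distrib prod_powr_distrib)
    also have "(\<Prod>r\<in>supp n. real_of_int (int_of_prime r ^ val r n)) = real_of_int n"
      using prod_supp_power_val[OF n] by (metis of_int_prod)
    also have "(\<Prod>r\<in>supp n. if r \<in> B then K else 1) = K ^ card (supp n \<inter> B)"
      using fin by (simp add: prod.If_cases Collect_mem_eq)
    also have "K ^ card (supp n \<inter> B) * real_of_int n powr \<delta> \<le> K ^ card B * real_of_int n powr \<delta>"
      using K finB by (intro mult_right_mono power_increasing card_mono) auto
    finally show ?thesis .
  qed
  thus ?thesis using one_le_power[OF K] by blast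
qed

lemma composite_small_prime:
  assumes "n > 1" "\<not> prime n"
  shows "\<exists>q. int_of_prime q dvd n \<and> (int_of_prime q)\<^sup>2 \<le> n"
proof -
  obtain m where m: "m \<ge> 0" "m dvd n" "m \<noteq> 1" "m \<noteq> n"
    using assms by (auto simp: prime_int_iff)
  then obtain k where k: "n = m * k" by auto
  have mk: "m > 1" "k > 1"
  proof -
    have "m \<noteq> 0" using k assms by auto
    thus "m > 1" using m by auto
    hence "k > 0" using k assms zero_less_mult_pos[of m k] by simp
    moreover have "k \<noteq> 1" using k m by auto
    ultimately show "k > 1" by auto
  qed
  have *: "\<exists>q. int_of_prime q dvd n \<and> (int_of_prime q)\<^sup>2 \<le> n"
    if xy: "n = x * y" "x > 1" "x \<le> y" for x y
  proof -
    obtain q where q: "int_of_prime q dvd x" using supp_nonempty[OF xy(2)] by blast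
    hence "int_of_prime q \<le> x" using xy by (intro zdvd_imp_le) auto
    hence "int_of_prime q * int_of_prime q \<le> x * y"
      using xy int_of_prime_pos[of q] by (intro mult_mono) auto
    thus ?thesis using q xy by (intro exI[of _ q]) (simp add: power2_eq_square)
  qed
  show ?thesis using *[of m k] *[of k m] k mk by (cases "m \<le> k") (auto simp: mult.commute)
qed

section \<open>Independent solutions for a coprime triple\<close>

locale coprime_sum =
  fixes a b c :: int
  assumes abc: "abc_triple a b c"
begin

definition S :: "prime_number set" where "S = supp (a * b * c)"
definition V :: "prime_number \<Rightarrow> nat" where "V r = val r (a * b * c)"
text \<open>The coefficients of the linear equation: for a linear map with values \<open>z r\<close>
  at \<open>xi r\<close>, additivity of its derivative on \<open>a + b = c\<close> reads
  \<open>(\<Sum>r\<in>S. e r * z r) = 0\<close>.\<close>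

definition e :: "prime_number \<Rightarrow> int" where "e r = coef a r + coef b r - coef c r"
definition D :: "(prime_number \<Rightarrow> int) \<Rightarrow> int \<Rightarrow> int" where "D z n = (\<Sum>r\<in>S. coef n r * z r)"

text \<open>For solutions of \<open>D z c = D z a + D z b\<close> this is the vanishing of \<open>W\<close>:
  \<open>a\<close>, \<open>b\<close>, \<open>c\<close> then share one logarithmic derivative, which is an integer \<open>t\<close> by coprimality.\<close>

definition dependent :: "(prime_number \<Rightarrow> int) \<Rightarrow> bool" where
  "dependent z \<longleftrightarrow> (\<exists>t. \<forall>n\<in>{a, b, c}. D z n = n * t)"

text \<open>By coprimality this means that \<open>p\<close> and \<open>q\<close> divide different
  members. The three clauses are symmetric in \<open>a\<close>, \<open>b\<close>, \<open>c\<close>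
  and name the members on which both, one or the other of the coordinates at \<open>p\<close> and
  \<open>q\<close> drop out.\<close>

definition separated :: "prime_number \<Rightarrow> prime_number \<Rightarrow> bool" where
  "separated p q \<longleftrightarrow> (\<exists>n\<in>{a, b, c}. \<not> int_of_prime p dvd n \<and> \<not> int_of_prime q dvd n) \<and>
     (\<exists>n\<in>{a, b, c}. int_of_prime p dvd n \<and> \<not> int_of_prime q dvd n) \<and>
     (\<exists>n\<in>{a, b, c}. int_of_prime q dvd n \<and> \<not> int_of_prime p dvd n)"

lemma pos: "a > 0" "b > 0" "c > 0" and sum: "a + b = c"
  using abc by (auto simp: abc_triple_def)

lemma pos': "n \<in> {a, b, c} \<Longrightarrow> n > 0"
  using pos by auto

lemma le_c: "n \<in> {a, b, c} \<Longrightarrow> n \<le> c"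
  using pos sum by auto

lemma not_dvd_two:
  "\<not> (int_of_prime r dvd a \<and> int_of_prime r dvd b)"
  "\<not> (int_of_prime r dvd a \<and> int_of_prime r dvd c)"
  "\<not> (int_of_prime r dvd b \<and> int_of_prime r dvd c)"
proof -
  have *: "\<not> (int_of_prime r dvd x \<and> int_of_prime r dvd y)" if "coprime x y" for x y
    using that coprime_common_divisor[of x y "int_of_prime r"] prime_elem_int_of_prime[of r]
    by (auto dest: prime_elem_not_unit)
  show "\<not> (int_of_prime r dvd a \<and> int_of_prime r dvd b)"
    "\<not> (int_of_prime r dvd a \<and> int_of_prime r dvd c)"
    "\<not> (int_of_prime r dvd b \<and> int_of_prime r dvd c)"
    using abc_triple_pairwise[OF abc] by (auto dest!: *)
qed

lemma separated_intros:
  "int_of_prime p dvd a \<Longrightarrow> int_of_prime q dvd b \<Longrightarrow> separated p q"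
  "int_of_prime p dvd a \<Longrightarrow> int_of_prime q dvd c \<Longrightarrow> separated p q"
  "int_of_prime p dvd b \<Longrightarrow> int_of_prime q dvd c \<Longrightarrow> separated p q"
  unfolding separated_def using not_dvd_two by blast+

lemma finite_S: "finite S"
  unfolding S_def using pos by (intro finite_supp) auto

lemma S_eq: "S = supp a \<union> supp b \<union> supp c"
  unfolding S_def by (simp add: supp_mult)

lemma in_S_cases:
  assumes "r \<in> S"
  obtains n where "n \<in> {a, b, c}" "int_of_prime r dvd n"
  using assms by (auto simp: S_eq supp_def)

lemma in_S: "n \<in> {a, b, c} \<Longrightarrow> int_of_prime r dvd n \<Longrightarrow> r \<in> S"
  by (auto simp: S_eq supp_def)

lemma V_eq: "V r = val r a + val r b + val r c"
  unfolding V_def using pos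
  by (simp add: prime_elem_multiplicity_mult_distrib[OF prime_elem_int_of_prime])

lemma V_eq_val:
  assumes "n \<in> {a, b, c}" "int_of_prime r dvd n"
  shows "V r = val r n"
  using assms not_dvd_two[of r] val_eq_0[of r a] val_eq_0[of r b] val_eq_0[of r c]
  unfolding V_eq by auto

lemma V_pos: "r \<in> S \<Longrightarrow> V r > 0"
  by (metis in_S_cases V_eq_val val_pos pos' less_irrefl)

lemma sum_e_eq: "(\<Sum>r\<in>S. e r * z r) = D z a + D z b - D z c"
  unfolding D_def e_def by (simp add: algebra_simps sum.distrib sum_subtractf)

lemma dependentI:
  assumes "D z c = D z a + D z b" and W: "a * D z b = b * D z a"
  shows "dependent z"
proof -
  have "a dvd b * D z a" using W by (metis dvd_triv_left)
  hence "a dvd D z a"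
    using abc_triple_pairwise[OF abc] by (simp add: coprime_dvd_mult_right_iff)
  then obtain t where t: "D z a = a * t" by auto
  hence "a * D z b = a * (b * t)" using W by simp
  hence "D z b = b * t" using pos by simp
  thus ?thesis using t assms sum unfolding dependent_def by (auto simp: algebra_simps)
qed

section \<open>Rigidity of dependent solutions\<close>

lemma dependent_dvd:
  assumes "dependent z" "r \<in> S"
  shows "int_of_prime r dvd int (V r) * z r"
proof -
  obtain n where n: "n \<in> {a, b, c}" "int_of_prime r dvd n" using assms in_S_cases by blast
  have "n dvd (\<Sum>s\<in>S. coef n s * z s)"
    using assms n unfolding dependent_def D_def by force
  from dvd_val_times_of_dvd_derivative[OF pos'[OF n(1)] finite_S assms(2) n(2) this]
  show ?thesis using V_eq_val[OF n] by simp
qed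

text \<open>On the member free of \<open>p\<close> and \<open>q\<close> the derivative is 0, so
  \<open>t = 0\<close>. On the member divisible by \<open>p\<close> but not \<open>q\<close> only
  the term at \<open>p\<close> survives, with a positive coefficient, so \<open>z p = 0\<close>;
  likewise for \<open>q\<close>.\<close>

lemma dependent_determined:
  assumes z: "dependent z" "\<forall>r\<in>S - {p, q}. z r = 0" and pq: "separated p q" and r: "r \<in> S"
  shows "z r = 0"
proof -
  obtain t where t: "\<And>n. n \<in> {a, b, c} \<Longrightarrow> D z n = n * t"
    using z(1) unfolding dependent_def by blast
  obtain n where n: "n \<in> {a, b, c}" "\<not> int_of_prime p dvd n" "\<not> int_of_prime q dvd n"
    using pq unfolding separated_def by blast
  have "D z n = 0"
    unfolding D_def using n z(2) by (intro sum.neutral) (auto simp: coef_eq_0)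
  hence t0: "t = 0" using t[OF n(1)] pos'[OF n(1)] by simp
  have *: "z p' = 0" if n: "n \<in> {a, b, c}" "int_of_prime p' dvd n" "\<not> int_of_prime q' dvd n"
    and "{p', q'} = {p, q}" for p' q' n
  proof -
    have z': "\<forall>r\<in>S - {p', q'}. z r = 0" using z(2) that(4) by simp
    have "D z n = (\<Sum>s\<in>{p'}. coef n s * z s)"
      unfolding D_def
    proof (rule sum.mono_neutral_right[OF finite_S])
      show "{p'} \<subseteq> S" using n in_S by auto
      show "\<forall>i\<in>S - {p'}. coef n i * z i = 0" using z' n(3) coef_eq_0 by auto
    qed
    hence "coef n p' * z p' = 0" using t[OF n(1)] t0 by simp
    thus ?thesis using coef_pos[OF pos'[OF n(1)] n(2)] by simp
  qed
  have "z p = 0" using pq *[OF _ _ _ refl] unfolding separated_def by blast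
  moreover have "z q = 0" using pq *[of _ q p, OF _ _ _ insert_commute] unfolding separated_def by blast
  ultimately show ?thesis using z(2) r by blast
qed

section \<open>From integer vectors to linear maps on \<open>Omega\<close>\<close>

lemma ex_psi:
  assumes supp: "\<And>r. r \<notin> S \<Longrightarrow> z r = 0" and e: "(\<Sum>r\<in>S. e r * z r) = 0"
    and z: "\<not> dependent z" and bound: "\<And>r. real_of_int \<bar>z r\<bar> \<le> B" "B < K"
  shows "\<exists>\<psi>\<in>T_pair a b. psi_independent \<psi> a b \<and> psi_norm \<psi> < ereal K"
proof -
  \<comment> \<open>\<open>frag_extend\<close> takes values in a free abelian group, so the integers
    are modelled as the free group on the single generator \<open>()\<close>, and
    \<open>lookup\<close> reads off the coefficient.\<close>
  define \<psi> :: "Omega \<Rightarrow> int" where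
    "\<psi> \<omega> = Poly_Mapping.lookup (frag_extend (\<lambda>r. frag_cmul (z r) (frag_of ())) \<omega>) ()" for \<omega>
  have xi: "\<psi> (xi r) = z r" for r by (simp add: \<psi>_def xi_def)
  have "module (times :: int \<Rightarrow> int \<Rightarrow> int)" by unfold_locales (simp_all add: algebra_simps)
  hence hom: "module_hom frag_cmul times \<psi>"
    unfolding module_hom_def module_hom_axioms_def
    using module_frag_cmul by (auto simp: \<psi>_def frag_extend_add frag_extend_cmul Poly_Mapping.lookup_add)
  \<comment> \<open>A supremum preserves only non-strict bounds; strictness comes from
    \<open>B < K\<close>.\<close>
  have norm: "psi_norm \<psi> \<le> ereal B"
    unfolding psi_norm_def xi using bound by (intro SUP_least) auto
  have d: "d_psi \<psi> n = D z n" if n: "n \<in> {a, b, c}" for n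
  proof -
    have "d_psi \<psi> n = (\<Sum>r\<in>supp n. coef n r * z r)"
      using pos'[OF n] unfolding d_psi_def d_Omega_def o_def
      by (simp add: module_hom.sum[OF hom] module_hom.scale[OF hom] xi coef_def)
    also have "\<dots> = D z n" unfolding D_def
      using n by (intro sum.mono_neutral_left finite_S) (auto simp: S_eq supp_def coef_eq_0)
    finally show ?thesis .
  qed
  have Dc: "D z c = D z a + D z b" using e by (simp add: sum_e_eq)
  have "\<psi> \<in> T_pair a b"
    unfolding T_pair_def T_module_def supp_psi_def
    using hom norm d Dc supp by (auto simp: xi sum S_def intro: le_less_trans)
  moreover have "psi_independent \<psi> a b"
    using dependentI[OF Dc] z by (auto simp: psi_independent_def W_psi_def d)
  moreover have "psi_norm \<psi> < ereal K" using norm bound(2) by (auto intro: le_less_trans)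
  ultimately show ?thesis by blast
qed

text \<open>A member \<open>n\<close> contributes at most \<open>n * val r n / r\<close>, and
  \<open>n \<le> c\<close>. The division by \<open>r\<close> makes the coefficients at large primes
  small.\<close>

lemma abs_e_le: "int_of_prime r * \<bar>e r\<bar> \<le> c * int (V r)"
proof -
  have "\<bar>e r\<bar> \<le> coef a r + coef b r + coef c r"
    unfolding e_def using coef_nonneg[of _ r] pos by (smt (verit))
  hence "int_of_prime r * \<bar>e r\<bar> \<le> int_of_prime r * (coef a r + coef b r + coef c r)"
    using int_of_prime_ge_2[of r] by (intro mult_left_mono) auto
  also have "\<dots> = a * int (val r a) + b * int (val r b) + c * int (val r c)"
    by (simp add: distrib_left int_of_prime_times_coef)
  also have "\<dots> \<le> c * int (val r a) + c * int (val r b) + c * int (val r c)"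
    using le_c by (intro add_mono mult_right_mono) auto
  finally show ?thesis by (simp add: V_eq distrib_left)
qed

text \<open>Only one member is divisible by \<open>r\<close>, so nothing can cancel its positive
  coefficient.\<close>

lemma e_nonzero:
  assumes "r \<in> S"
  shows "e r \<noteq> 0"
proof -
  obtain n where n: "n \<in> {a, b, c}" "int_of_prime r dvd n" using assms in_S_cases by blast
  thus ?thesis
    using coef_pos[OF pos'[OF n(1)] n(2)] not_dvd_two[of r] coef_eq_0[of r a] coef_eq_0[of r b] coef_eq_0[of r c]
    unfolding e_def by auto
qed

lemma separated_in_S: "separated p q \<Longrightarrow> p \<in> S \<and> q \<in> S \<and> p \<noteq> q"
  unfolding separated_def using in_S by blast

text \<open>The vector with \<open>e q\<close> at \<open>p\<close> and \<open>- e p\<close> at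
  \<open>q\<close> solves the equation. A dependent vector supported on \<open>{p, q}\<close> would
  vanish, but \<open>e q\<close> is non-zero. The size comes from \<open>abs_e_le\<close>.\<close>

lemma ex_psi_large_primes:
  fixes K :: real
  assumes pq: "separated p q"
    and p: "real_of_int c * V p < K * real_of_int (int_of_prime p)" and q: "real_of_int c * V q < K * real_of_int (int_of_prime q)"
  shows "\<exists>\<psi>\<in>T_pair a b. psi_independent \<psi> a b \<and> psi_norm \<psi> < ereal K"
proof -
  have S: "p \<in> S" "q \<in> S" "p \<noteq> q" using separated_in_S[OF pq] by auto
  define z where "z r = (if r = p then e q else if r = q then - e p else 0)" for r
  have less: "real_of_int \<bar>e r\<bar> < K" if "real_of_int c * V r < K * real_of_int (int_of_prime r)" for r
  proof -
    have "real_of_int (int_of_prime r) * real_of_int \<bar>e r\<bar> \<le> real_of_int c * V r"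
      using abs_e_le[of r] by (metis of_int_le_iff of_int_mult of_int_of_nat_eq)
    hence "real_of_int \<bar>e r\<bar> * int_of_prime r < K * int_of_prime r" using that by (simp add: mult.commute)
    thus ?thesis using int_of_prime_ge_2[of r] by (simp add: mult_less_cancel_right)
  qed
  show ?thesis
  proof (rule ex_psi)
    show "z r = 0" if "r \<notin> S" for r using that S by (auto simp: z_def)
    have "(\<Sum>r\<in>S. e r * z r) = (\<Sum>r\<in>{p, q}. e r * z r)"
      by (rule sum.mono_neutral_right[OF finite_S]) (use S in \<open>auto simp: z_def\<close>)
    thus "(\<Sum>r\<in>S. e r * z r) = 0" using S by (simp add: z_def)
    show "\<not> dependent z"
    proof
      assume "dependent z"
      hence "z p = 0" by (rule dependent_determined[OF _ _ pq]) (use S in \<open>auto simp: z_def\<close>)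
      thus False using e_nonzero[OF S(2)] by (simp add: z_def)
    qed
    show "real_of_int \<bar>z r\<bar> \<le> max (real_of_int \<bar>e p\<bar>) (real_of_int \<bar>e q\<bar>)" for r
      by (auto simp: z_def)
    show "max (real_of_int \<bar>e p\<bar>) (real_of_int \<bar>e q\<bar>) < K"
      using less[OF p] less[OF q] by simp
  qed
qed

text \<open>The number of divisors of \<open>a * b * c\<close>. It absorbs every loss caused by multiplicities, by
  primes \<open>r\<close> dividing \<open>V r\<close> and by factors \<open>2 ^ card S\<close>.\<close>

definition \<tau> :: nat where "\<tau> = (\<Prod>r\<in>S. V r + 1)"

section \<open>Estimates by the number of divisors, and the counting argument\<close>

lemma sum_abs_e_le: "(\<Sum>r\<in>S. \<bar>e r\<bar>) \<le> c * int \<tau>"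
proof -
  have "\<bar>e r\<bar> \<le> c * int (V r)" for r
    using abs_e_le[of r] int_of_prime_ge_2[of r] mult_right_mono[of 1 "int_of_prime r" "\<bar>e r\<bar>"] by simp
  hence "(\<Sum>r\<in>S. \<bar>e r\<bar>) \<le> c * int (\<Sum>r\<in>S. V r)"
    unfolding of_nat_sum sum_distrib_left by (intro sum_mono) auto
  also have "\<dots> \<le> c * int \<tau>"
    unfolding \<tau>_def using pos sum_le_prod[of S V]
    by (intro mult_left_mono) (simp_all only: of_nat_le_iff add.commute le_refl less_imp_le)
  finally show ?thesis .
qed

lemma prod_V_le:
  assumes "T \<subseteq> S"
  shows "(\<Prod>r\<in>T. V r) \<le> \<tau>"
proof -
  have "(\<Prod>r\<in>T. V r) \<le> (\<Prod>r\<in>T. V r + 1)" by (intro prod_mono) auto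
  also have "\<dots> \<le> (\<Prod>r\<in>S - T. V r + 1) * (\<Prod>r\<in>T. V r + 1)"
    using prod_ge_1[of "S - T" "\<lambda>r. V r + 1"] by simp
  also have "\<dots> = \<tau>" unfolding \<tau>_def by (rule prod.subset_diff[OF assms finite_S, symmetric])
  finally show ?thesis .
qed

lemma two_power_le: "2 ^ card S \<le> \<tau>"
proof -
  have "2 ^ card S = (\<Prod>r\<in>S. 2 :: nat)" by simp
  also have "\<dots> \<le> \<tau>" unfolding \<tau>_def using V_pos by (intro prod_mono) (auto simp: Suc_le_eq)
  finally show ?thesis .
qed

lemma V_le: "r \<in> S \<Longrightarrow> V r \<le> \<tau>"
  using prod_V_le[of "{r}"] by simp

text \<open>The pigeonhole principle is applied with \<open>T = S - {p, q}\<close>. One factor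
  \<open>\<tau>\<close> bounds the sum of the \<open>\<bar>e r\<bar>\<close> relative to
  \<open>c\<close>, one bounds \<open>2 ^ (card S - 1)\<close>, and the third in
  \<open>large2\<close> bounds the product of the \<open>V r\<close> lost in passing from the
  radical to the moduli. \<open>large1\<close> and \<open>large2\<close> serve the two possible
  values of the minimum in \<open>pigeonhole_condition\<close>.\<close>

lemma ex_psi_small_primes:
  fixes H :: nat
  assumes pq: "separated p q" and H: "real H - 1 < K" "H \<ge> 1"
    and large1: "real H * real H > real_of_int c * real \<tau> ^ 2"
    and large2: "real H * real_of_int (rad (a * b * c)) >
      real_of_int c * real \<tau> ^ 3 * (real_of_int (int_of_prime p) * real_of_int (int_of_prime q))"
  shows "\<exists>\<psi>\<in>T_pair a b. psi_independent \<psi> a b \<and> psi_norm \<psi> < ereal K"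
proof -
  have S: "p \<in> S" "q \<in> S" "p \<noteq> q" using separated_in_S[OF pq] by auto
  define T where "T = S - {p, q}"
  have T: "T \<subseteq> S" "finite T" using finite_S by (auto simp: T_def)
  have S_eq_T: "S = insert p (insert q T)" "p \<notin> insert q T" "q \<notin> T" using S by (auto simp: T_def)
  hence card: "card S = card T + 2" using T by simp
  \<comment> \<open>If \<open>r\<close> divides \<open>V r\<close>, no congruence for
    \<open>z r\<close> is available and the modulus is 1; then \<open>r \<le> V r\<close>, so
    \<open>m r * V r\<close> is still at least \<open>r\<close>.\<close>
  define m where "m r = (if int_of_prime r dvd int (V r) then 1 else nat (int_of_prime r))" for r
  have m1: "m r \<ge> 1" for r using int_of_prime_ge_2[of r] by (auto simp: m_def)
  have tau1: "\<tau> \<ge> 1" unfolding \<tau>_def by (rule prod_ge_1) auto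
  have mV: "int_of_prime r \<le> int (m r) * int (V r)" if "r \<in> S" for r
  proof (cases "int_of_prime r dvd int (V r)")
    case True
    thus ?thesis using V_pos[OF that] by (auto simp: m_def dest: zdvd_imp_le)
  next
    case False
    thus ?thesis using V_pos[OF that] int_of_prime_ge_2[of r]
        mult_left_mono[of 1 "int (V r)" "int_of_prime r"] by (auto simp: m_def)
  qed
  have "rad (a * b * c) = (\<Prod>r\<in>S. int_of_prime r)"
    unfolding S_def using pos by (intro rad_eq_prod_supp) auto
  also have "\<dots> = int_of_prime p * int_of_prime q * (\<Prod>r\<in>T. int_of_prime r)"
    using S_eq_T T by (simp add: mult.assoc)
  also have "\<dots> \<le> int_of_prime p * int_of_prime q * (\<Prod>r\<in>T. int (m r) * int (V r))"
    using mV T(1) int_of_prime_pos by (intro mult_left_mono prod_mono) (auto intro: less_imp_le)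
  also have "(\<Prod>r\<in>T. int (m r) * int (V r)) = (\<Prod>r\<in>T. int (m r)) * int (\<Prod>r\<in>T. V r)"
    by (simp add: prod.distrib)
  also have "int_of_prime p * int_of_prime q * \<dots> \<le> int_of_prime p * int_of_prime q * ((\<Prod>r\<in>T. int (m r)) * int \<tau>)"
    using prod_V_le[OF T(1), folded of_nat_le_iff[where 'a = int]] int_of_prime_pos[of p] int_of_prime_pos[of q]
    by (intro mult_left_mono) (auto intro!: prod_nonneg simp del: of_nat_prod)
  finally have "real_of_int (rad (a * b * c)) \<le>
      real_of_int (int_of_prime p * int_of_prime q * ((\<Prod>r\<in>T. int (m r)) * int \<tau>))"
    by (simp only: of_int_le_iff)
  hence rad: "real_of_int (rad (a * b * c)) \<le>
      real_of_int (int_of_prime p) * real_of_int (int_of_prime q) * ((\<Prod>r\<in>T. real (m r)) * real \<tau>)"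
    by simp
  have "\<exists>z. (\<forall>r. r \<notin> S \<longrightarrow> z r = 0) \<and> (\<forall>r. \<bar>z r\<bar> < int H) \<and>
      (\<Sum>r\<in>S. e r * z r) = 0 \<and> \<not> dependent z"
  proof (rule pigeonhole_linear_form[where T = T and m = m and N = "nat c * \<tau>"])
    show "int (m r) dvd z r" if "dependent z" "r \<in> T" for z r
      using dependent_dvd[OF that(1), of r] that(2) T int_of_prime_ge_2[of r]
        prime_dvd_mult_iff[OF prime_int_of_prime, of r "int (V r)" "z r"]
      by (auto simp: m_def)
    show "z r = 0" if "dependent z" "\<forall>r\<in>T. z r = 0" "r \<in> S" for z r
      using dependent_determined[OF that(1) _ pq that(3)] that(2) by (auto simp: T_def)
    have half: "2 * 2 ^ (card S - 1) = (2 ^ card S :: real)" using card by simp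
    have "real \<tau> \<ge> 2 ^ card S" using two_power_le by (metis of_nat_le_iff of_nat_numeral of_nat_power)
    hence "real \<tau> \<ge> 2 ^ (card S - 1)" using half by (smt (verit) zero_le_power)
    hence "real (nat c * \<tau>) * 2 ^ (card S - 1) \<le> real (nat c * \<tau>) * real \<tau>"
      by (intro mult_left_mono) auto
    also have "\<dots> = real_of_int c * real \<tau> ^ 2" using pos by (simp add: power2_eq_square)
    finally have N: "real (nat c * \<tau>) * 2 ^ (card S - 1) \<le> real_of_int c * real \<tau> ^ 2" .
    have "real_of_int c * real \<tau> ^ 2 < real H * (\<Prod>r\<in>T. real (m r))"
    proof -
      define x where "x = real_of_int (int_of_prime p) * real_of_int (int_of_prime q) * real \<tau>"
      have x: "x > 0" using int_of_prime_ge_2[of p] int_of_prime_ge_2[of q] tau1 by (simp add: x_def)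
      have "real_of_int c * real \<tau> ^ 2 * x < real H * real_of_int (rad (a * b * c))"
        using large2 by (simp add: x_def power3_eq_cube power2_eq_square algebra_simps)
      also have "\<dots> \<le> real H * (\<Prod>r\<in>T. real (m r)) * x"
        using mult_left_mono[OF rad, of "real H"] by (simp add: x_def algebra_simps)
      finally show ?thesis using x by (simp add: mult_less_cancel_right)
    qed
    hence "real H * min (real H) (\<Prod>r\<in>T. real (m r)) > real (nat c * \<tau>) * 2 ^ (card S - 1)"
      using N large1 by (auto simp: min_def)
    thus "2 * H * (nat c * \<tau>) * (\<Prod>r\<in>T. (H - 1) div m r + 1) < H ^ card S"
      using T card m1 H(2) by (intro pigeonhole_condition) auto
    show "1 \<le> nat c * \<tau>" using pos tau1 by (simp add: Suc_le_eq)
    show "(\<Sum>r\<in>S. \<bar>e r\<bar>) \<le> int (nat c * \<tau>)" using sum_abs_e_le pos by simp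
  qed (use finite_S T m1 H in auto)
  then obtain z where z: "\<And>r. r \<notin> S \<Longrightarrow> z r = 0" "\<And>r. \<bar>z r\<bar> < int H"
    "(\<Sum>r\<in>S. e r * z r) = 0" "\<not> dependent z" by blast
  show ?thesis
  proof (rule ex_psi[OF z(1,3,4)])
    \<comment> \<open>Integers below \<open>H\<close> are at most \<open>H - 1\<close>, which allows
      \<open>H\<close> to be \<open>K\<close> rounded up.\<close>
    show "real_of_int \<bar>z r\<bar> \<le> real H - 1" for r
      using z(2)[of r] by linarith
  qed (use H in auto)
qed

section \<open>Choosing the two primes\<close>

lemma separated_primes_cases:
  fixes Y :: real
  assumes form: "\<not> one_N_prime_form a b c" and Y: "Y \<le> sqrt (real_of_int c)"
  obtains (large) p q where "separated p q" "real_of_int (int_of_prime p) > Y" "real_of_int (int_of_prime q) > Y"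
  | (small) p q where "separated p q"
      "real_of_int (int_of_prime p) * real_of_int (int_of_prime q) \<le> Y * sqrt (real_of_int c)"
proof -
  define good where "good p q \<longleftrightarrow> separated p q \<and>
    (real_of_int (int_of_prime p) > Y \<and> real_of_int (int_of_prime q) > Y \<or>
    real_of_int (int_of_prime p) * real_of_int (int_of_prime q) \<le> Y * sqrt (real_of_int c))" for p q
  \<comment> \<open>If \<open>u\<close> is not \<open>big\<close>, all its primes are at most
    \<open>Y\<close>, so any of them pairs with a prime of \<open>v\<close> up to
    \<open>sqrt c\<close>, which exists when \<open>v\<close> is \<open>smooth\<close>. If both are
    \<open>big\<close>, two large primes are available.\<close>
  define big where "big n \<longleftrightarrow> (\<exists>p. int_of_prime p dvd n \<and> real_of_int (int_of_prime p) > Y)" for n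
  define smooth where "smooth n \<longleftrightarrow> (\<exists>p. int_of_prime p dvd n \<and> real_of_int (int_of_prime p) \<le> sqrt (real_of_int c))" for n
  have smooth: "smooth n" if "n > 1" "\<not> big n" for n
    using supp_nonempty[OF that(1)] that(2) Y unfolding big_def smooth_def by force
  have prod_le: "real_of_int (int_of_prime p) * real_of_int (int_of_prime q) \<le> Y * sqrt (real_of_int c)"
    if "real_of_int (int_of_prime p) \<le> Y" "real_of_int (int_of_prime q) \<le> sqrt (real_of_int c)" for p q
    using that int_of_prime_pos[of p] int_of_prime_pos[of q] by (intro mult_mono) (auto intro: order_trans[rotated])
  have pair: "\<exists>p q. good p q"
    if uv: "u > 1" "v > 1" "\<And>p q. int_of_prime p dvd u \<Longrightarrow> int_of_prime q dvd v \<Longrightarrow> separated p q"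
      and h: "big u \<and> big v \<or> smooth v \<and> \<not> big u \<or> smooth u \<and> \<not> big v" for u v
  proof -
    consider "big u" "big v" | "smooth v" "\<not> big u" | "smooth u" "\<not> big v" using h by blast
    thus ?thesis
    proof cases
      case 1
      thus ?thesis using uv(3) unfolding good_def big_def by blast
    next
      case 2
      obtain p where p: "int_of_prime p dvd u" using supp_nonempty[OF uv(1)] by blast
      obtain q where q: "int_of_prime q dvd v" "real_of_int (int_of_prime q) \<le> sqrt (real_of_int c)"
        using 2 unfolding smooth_def by blast
      have "real_of_int (int_of_prime p) \<le> Y" using 2 p unfolding big_def by force
      hence "good p q" using prod_le q uv(3)[OF p q(1)] by (simp add: good_def)
      thus ?thesis by blast
    next
      case 3
      obtain q where q: "int_of_prime q dvd v" using supp_nonempty[OF uv(2)] by blast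
      obtain p where p: "int_of_prime p dvd u" "real_of_int (int_of_prime p) \<le> sqrt (real_of_int c)"
        using 3 unfolding smooth_def by blast
      have "real_of_int (int_of_prime q) \<le> Y" using 3 q unfolding big_def by force
      hence "good p q" using prod_le[of q p] p uv(3)[OF p(1) q] by (simp add: good_def mult.commute)
      thus ?thesis by blast
    qed
  qed
  have composite: "smooth n" if n: "n \<in> {a, b, c}" "n > 1" "\<not> prime n" for n
  proof -
    obtain q where q: "int_of_prime q dvd n" "(int_of_prime q)\<^sup>2 \<le> n"
      using composite_small_prime[OF n(2,3)] by blast
    hence "(int_of_prime q)\<^sup>2 \<le> c" using le_c[OF n(1)] by simp
    hence "(real_of_int (int_of_prime q))\<^sup>2 \<le> real_of_int c" by (metis of_int_le_iff of_int_power)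
    hence "real_of_int (int_of_prime q) \<le> sqrt (real_of_int c)" by (rule real_le_rsqrt)
    thus ?thesis using q unfolding smooth_def by blast
  qed
  have not_form: "\<not> prime q" if "N > 0" "{#a, b, c#} = {#1, N, q#}" for N q
    using form that unfolding one_N_prime_form_def by blast
  have "\<exists>p q. good p q"
  proof (cases "a = 1 \<or> b = 1")
    case False
    hence gt: "a > 1" "b > 1" "c > 1" using pos sum by auto
    hence sm: "big a \<or> smooth a" "big b \<or> smooth b" "big c \<or> smooth c" using smooth by blast+
    \<comment> \<open>Among three members two agree on being \<open>big\<close>. If neither is, both
      are \<open>smooth\<close>, because \<open>Y \<le> sqrt c\<close>.\<close>
    consider "big a \<and> big b \<or> \<not> big a \<and> \<not> big b" | "big a \<and> big c \<or> \<not> big a \<and> \<not> big c"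
      | "big b \<and> big c \<or> \<not> big b \<and> \<not> big c" by blast
    thus ?thesis
    proof cases
      case 1
      show ?thesis by (rule pair[OF gt(1,2)]) (use 1 sm in \<open>auto intro: separated_intros\<close>)
    next
      case 2
      show ?thesis by (rule pair[OF gt(1,3)]) (use 2 sm in \<open>auto intro: separated_intros\<close>)
    next
      case 3
      show ?thesis by (rule pair[OF gt(2,3)]) (use 3 sm in \<open>auto intro: separated_intros\<close>)
    qed
  next
    case True
    \<comment> \<open>The triple \<open>(1, 1, 2)\<close> is of the excluded form, with
      \<open>N = 1\<close> and \<open>q = 2\<close>.\<close>
    have "\<not> (a = 1 \<and> b = 1)"
      using not_form[of 1 2] sum by auto
    then consider "a = 1" "b > 1" | "b = 1" "a > 1" using True pos by linarith
    thus ?thesis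
    proof cases
      case 1
      have c: "c > 1" using 1 sum by simp
      have "\<not> prime b" "\<not> prime c"
        using 1 pos not_form[of c b] not_form[of b c] by (auto simp: add_mset_commute)
      hence "smooth b" "smooth c" using composite 1 c by auto
      thus ?thesis by (intro pair[OF 1(2) c]) (auto intro: separated_intros)
    next
      case 2
      have c: "c > 1" using 2 sum by simp
      have "\<not> prime a" "\<not> prime c"
        using 2 pos not_form[of c a] not_form[of a c] by (auto simp: add_mset_commute)
      hence "smooth a" "smooth c" using composite 2 c by auto
      thus ?thesis by (intro pair[OF 2(2) c]) (auto intro: separated_intros)
    qed
  qed
  thus ?thesis using that unfolding good_def by blast
qed

section \<open>Balancing the two cases\<close>

lemma ex_psi_of_tau_bound:
  fixes M \<epsilon> :: real
  assumes M: "1 < M" and \<epsilon>: "\<epsilon> > 0" and \<tau>: "real \<tau> ^ 3 < real_of_int c powr \<epsilon>"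
    and rad: "real_of_int c < real_of_int (rad (a * b * c)) powr M"
    and form: "\<not> one_N_prime_form a b c"
  shows "\<exists>\<psi>\<in>T_pair a b. psi_independent \<psi> a b \<and>
    psi_norm \<psi> < ereal (real_of_int c powr (5 / 4 - 1 / (2 * M) + \<epsilon>))"
proof -
  define x where "x = real_of_int c"
  define \<eta> where "\<eta> = 5 / 4 - 1 / (2 * M) + \<epsilon>"
  \<comment> \<open>Up to \<open>x powr \<epsilon>\<close>, large primes require
    \<open>K = x / Y\<close>, and small ones require
    \<open>K = x * Y * sqrt x / x powr (1 / M)\<close>. Equating the two gives this
    \<open>Y\<close>.\<close>
  define Y where "Y = x powr (1 / (2 * M) - 1 / 4)"
  define K where "K = x powr \<eta>"
  have x: "x \<ge> 1" using pos by (simp add: x_def)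
  have K: "K > 0" using x by (simp add: K_def)
  have M': "1 / M < 1" "1 / (2 * M) < 1 / 2" using M by auto
  have tau1: "real \<tau> \<ge> 1" using two_power_le by (metis of_nat_1 of_nat_le_iff one_le_numeral one_le_power order_trans)
  have sqrt: "sqrt x = x powr (1 / 2)" using x by (simp add: powr_half_sqrt)
  have Y: "Y \<le> sqrt x"
    unfolding Y_def sqrt using x M' by (intro powr_mono) auto
  have KY: "K * Y = x * x powr \<epsilon>"
  proof -
    have "K * Y = x powr (\<eta> + (1 / (2 * M) - 1 / 4))" by (simp add: K_def Y_def powr_add)
    also have "\<eta> + (1 / (2 * M) - 1 / 4) = 1 + \<epsilon>" by (simp add: \<eta>_def)
    finally show ?thesis using x by (simp add: powr_add)
  qed
  have "\<exists>\<psi>\<in>T_pair a b. psi_independent \<psi> a b \<and> psi_norm \<psi> < ereal K"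
  proof (cases rule: separated_primes_cases[OF form Y[unfolded x_def], case_names large small])
    case (large p q)
    have bound: "x * V r < K * int_of_prime r" if "r \<in> S" "real_of_int (int_of_prime r) > Y" for r
    proof -
      have "real (V r) \<le> real \<tau>" using V_le[OF that(1)] by simp
      also have "\<dots> \<le> real \<tau> ^ 3" using tau1 by (intro self_le_power) auto
      also have "\<dots> < x powr \<epsilon>" using \<tau> by (simp add: x_def)
      finally have "x * V r < x * x powr \<epsilon>" using x by simp
      also have "\<dots> = K * Y" by (simp add: KY)
      also have "\<dots> < K * int_of_prime r" using K that(2) by simp
      finally show ?thesis .
    qed
    show ?thesis
      by (rule ex_psi_large_primes[OF large(1)])
        (use bound large separated_in_S[OF large(1)] in \<open>simp_all add: x_def\<close>)
  next
    case (small p q)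
    define H where "H = nat \<lceil>K\<rceil>"
    have H: "real H \<ge> K" "real H - 1 < K" "H \<ge> 1"
      using K by (auto simp: H_def) linarith+
    have c\<tau>: "x * real \<tau> ^ 3 < x * x powr \<epsilon>" using \<tau> x by (simp add: x_def)
    show ?thesis
    proof (rule ex_psi_small_primes[OF small(1) H(2,3)])
      have "x * real \<tau> ^ 2 \<le> x * real \<tau> ^ 3" using x tau1 by (intro mult_left_mono power_increasing) auto
      also note c\<tau>
      also have "x * x powr \<epsilon> = x powr (1 + \<epsilon>)" using x by (simp add: powr_add)
      also have "\<dots> \<le> x powr (\<eta> + \<eta>)" using x M' \<epsilon> by (intro powr_mono) (auto simp: \<eta>_def)
      also have "\<dots> = K * K" by (simp only: K_def powr_add)
      also have "\<dots> \<le> real H * real H" using H K by (intro mult_mono) auto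
      finally show "real_of_int c * real \<tau> ^ 2 < real H * real H" by (simp add: x_def)
      define P where "P = real_of_int (int_of_prime p) * real_of_int (int_of_prime q)"
      have P: "P > 0" using int_of_prime_pos[of p] int_of_prime_pos[of q] by (simp add: P_def)
      have "rad (a * b * c) \<ge> 0"
        unfolding rad_def by (intro prod_nonneg) (auto dest: in_prime_factors_imp_prime prime_ge_0_int)
      hence R: "x powr (1 / M) \<le> real_of_int (rad (a * b * c))"
        using rad M powr_mono2[of "1 / M" x "real_of_int (rad (a * b * c)) powr M"] x
        by (simp add: x_def powr_powr)
      have "x * real \<tau> ^ 3 * P < x * x powr \<epsilon> * P" by (rule mult_strict_right_mono[OF c\<tau> P])
      also have "\<dots> \<le> x * x powr \<epsilon> * (Y * sqrt x)"
        using small(2) x by (intro mult_left_mono) (auto simp: P_def x_def)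
      also have "\<dots> = x powr (1 + \<epsilon> + (1 / (2 * M) - 1 / 4) + 1 / 2)"
      proof -
        have "x powr 1 = x" using x by simp
        thus ?thesis unfolding sqrt Y_def by (simp only: powr_add mult.assoc)
      qed
      also have "1 + \<epsilon> + (1 / (2 * M) - 1 / 4) + 1 / 2 = \<eta> + 1 / M"
        unfolding \<eta>_def using M by (simp add: field_simps)
      also have "x powr (\<eta> + 1 / M) = K * x powr (1 / M)" by (simp add: K_def powr_add)
      also have "\<dots> \<le> real H * real_of_int (rad (a * b * c))"
        using H K R by (intro mult_mono) auto
      finally show "real_of_int c * real \<tau> ^ 3 * (real_of_int (int_of_prime p) * real_of_int (int_of_prime q)) <
          real H * real_of_int (rad (a * b * c))" by (simp add: x_def P_def)
    qed
  qed
  thus ?thesis by (simp add: K_def \<eta>_def x_def)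
qed

end

section \<open>Finiteness of the exceptional set\<close>

theorem theorem4p5:
  fixes M :: real
  assumes "1 < M" and "M < 2"
    and "\<And>a b c :: int. abc_triple a b c \<Longrightarrow>
           real_of_int c < real_of_int (rad (a * b * c)) powr M"
  shows "\<forall>\<eta>::real. \<eta> > 1 - (2 - M) / (4 * M) \<longrightarrow>
           finite {(a, b, c). abc_triple a b c \<and> \<not> one_N_prime_form a b c \<and>
             \<not> (\<exists>\<psi>\<in>T_pair a b. psi_independent \<psi> a b \<and>
                   psi_norm \<psi> < ereal (real_of_int c powr \<eta>))}"
proof (intro allI impI)
  fix \<eta> :: real
  assume \<eta>: "\<eta> > 1 - (2 - M) / (4 * M)"
  define \<epsilon> where "\<epsilon> = \<eta> - (5 / 4 - 1 / (2 * M))"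
  have "1 - (2 - M) / (4 * M) = 5 / 4 - 1 / (2 * M)" using assms(1) by (simp add: field_simps)
  hence \<epsilon>: "\<epsilon> > 0" "\<eta> = 5 / 4 - 1 / (2 * M) + \<epsilon>" using \<eta> by (auto simp: \<epsilon>_def)
  \<comment> \<open>Since \<open>a * b * c \<le> c ^ 3\<close>, the cube of \<open>\<tau>\<close> is
    at most \<open>C ^ 3 * c powr (9 * \<delta>)\<close>; the choice makes
    \<open>9 * \<delta>\<close> equal to \<open>\<epsilon> / 2\<close>.\<close>
  define \<delta> where "\<delta> = \<epsilon> / 18"
  have \<delta>: "\<delta> > 0" using \<epsilon> by (simp add: \<delta>_def)
  obtain C where C: "C \<ge> 1"
    "\<And>n. n > 0 \<Longrightarrow> real (\<Prod>r\<in>supp n. val r n + 1) \<le> C * real_of_int n powr \<delta>"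
    using divisor_bound[OF \<delta>] by blast
  \<comment> \<open>Beyond \<open>c0\<close> the constant \<open>C ^ 3\<close> is less than
    \<open>c powr (\<epsilon> / 2)\<close>, the other half of the allowance
    \<open>\<epsilon>\<close>.\<close>
  define c0 where "c0 = \<lceil>(C ^ 3) powr (2 / \<epsilon>)\<rceil>"
  let ?bad = "{(a, b, c). abc_triple a b c \<and> \<not> one_N_prime_form a b c \<and>
             \<not> (\<exists>\<psi>\<in>T_pair a b. psi_independent \<psi> a b \<and>
                   psi_norm \<psi> < ereal (real_of_int c powr \<eta>))}"
  \<comment> \<open>Bounding \<open>c\<close> suffices, since \<open>a\<close> and \<open>b\<close>
    are positive and less than \<open>c\<close>.\<close>
  have "?bad \<subseteq> {0..c0} \<times> {0..c0} \<times> {0..c0}"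
  proof safe
    fix a b c
    assume abc: "abc_triple a b c" and form: "\<not> one_N_prime_form a b c"
      and none: "\<not> (\<exists>\<psi>\<in>T_pair a b. psi_independent \<psi> a b \<and> psi_norm \<psi> < ereal (real_of_int c powr \<eta>))"
    interpret coprime_sum a b c by unfold_locales (rule abc)
    have "c \<le> c0"
    proof (rule ccontr)
      assume "\<not> c \<le> c0"
      hence "(C ^ 3) powr (2 / \<epsilon>) < real_of_int c" unfolding c0_def by (simp add: ceiling_less_iff not_le)
      hence "((C ^ 3) powr (2 / \<epsilon>)) powr (\<epsilon> / 2) < real_of_int c powr (\<epsilon> / 2)"
        using \<epsilon> by (intro powr_less_mono2) auto
      hence C3: "C ^ 3 < real_of_int c powr (\<epsilon> / 2)" using \<epsilon> C by (simp add: powr_powr)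
      have "real \<tau> \<le> C * real_of_int (a * b * c) powr \<delta>"
        unfolding \<tau>_def S_def V_def using pos by (intro C(2)) auto
      also have "\<dots> \<le> C * (real_of_int c ^ 3) powr \<delta>"
      proof -
        have "a * b * c \<le> c * c * c" using pos sum by (intro mult_mono) auto
        hence "real_of_int (a * b * c) \<le> real_of_int (c * c * c)" by (simp only: of_int_le_iff)
        hence "real_of_int (a * b * c) \<le> real_of_int c ^ 3" by (simp add: power3_eq_cube)
        thus ?thesis using C pos \<delta> by (intro mult_left_mono powr_mono2) auto
      qed
      finally have "real \<tau> ^ 3 \<le> (C * (real_of_int c ^ 3) powr \<delta>) ^ 3" by (intro power_mono) auto
      also have "\<dots> = C ^ 3 * real_of_int c powr (\<epsilon> / 2)"
        using pos powr_powr[of "real_of_int c" 3 \<delta>] by (simp add: power_mult_distrib powr_power \<delta>_def)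
      also have "\<dots> < real_of_int c powr (\<epsilon> / 2) * real_of_int c powr (\<epsilon> / 2)"
        using C3 pos by (intro mult_strict_right_mono) auto
      also have "\<dots> = real_of_int c powr \<epsilon>" by (simp flip: powr_add)
      finally show False
        using ex_psi_of_tau_bound[OF assms(1) \<epsilon>(1) _ assms(3)[OF abc] form] none \<epsilon>(2) by simp
    qed
    thus "a \<in> {0..c0}" "b \<in> {0..c0}" "c \<in> {0..c0}" using pos sum by auto
  qed
  thus "finite ?bad" by (rule finite_subset) auto
qed

end
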